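(* There does not exist an optimal $(3k(k-1)+4,k,1)$-optical orthogonal code if $k = (4^{a+3}(24c+23)-2)/3$ for some integers $a ,c \geq 0$, or if $k = 4^{a+3}(8c+5)$ for some integers $a , c \geq 0$.
   Context: A $(v,k,1)$-optical orthogonal code ($(v,k,1)$-OOC) of size $n$ is a set $\mathcal{C}$ of $n$ $(0,1)$-vectors of length $v$, each of Hamming weight $k$, such that (with subscripts reduced modulo $v$): for every $\mathbf{x}=(x_0,\dots,x_{v-1}) \in \mathcal{C}$ and every integer $0<\tau<v$, $\sum_{i=0}^{v-1} x_i x_{i+\tau} \le 1$; and for all $\mathbf{x}\ne\mathbf{y}$ in $\mathcal{C}$ and every integer $0\le\tau<v$, $\sum_{i=0}^{v-1} x_i y_{i+\tau} \le 1$. The size of a $(v,k,1)$-OOC is always at most $\left\lfloor \frac{v-1}{k(k-1)} \right\rfloor$; it is called optimal if its size equals $\left\lfloor \frac{v-1}{k(k-1)} \right\rfloor$. *)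

theory Defs
  imports Complex_Main
begin

text \<open>Vectors of length \<open>v\<close> are lists of length \<open>v\<close>, with coordinates indexed from \<open>0\<close>.\<close>

definition binary_vector :: "nat \<Rightarrow> nat list \<Rightarrow> bool" where
  "binary_vector v x \<longleftrightarrow> length x = v \<and> set x \<subseteq> {0, 1}"

definition hamming_weight :: "nat list \<Rightarrow> nat" where
  "hamming_weight x = card {i. i < length x \<and> x ! i \<noteq> 0}"

definition correlation :: "nat \<Rightarrow> nat list \<Rightarrow> nat list \<Rightarrow> nat \<Rightarrow> nat" where
  "correlation v x y \<tau> = (\<Sum>i<v. x ! i * y ! ((i + \<tau>) mod v))"

definition optical_orthogonal_code :: "nat \<Rightarrow> nat \<Rightarrow> nat list set \<Rightarrow> bool" where
  "optical_orthogonal_code v k C \<longleftrightarrow>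
     (\<forall>x\<in>C. binary_vector v x \<and> hamming_weight x = k) \<and>
     (\<forall>x\<in>C. \<forall>\<tau>. 0 < \<tau> \<and> \<tau> < v \<longrightarrow> correlation v x x \<tau> \<le> 1) \<and>
     (\<forall>x\<in>C. \<forall>y\<in>C. x \<noteq> y \<longrightarrow> (\<forall>\<tau><v. correlation v x y \<tau> \<le> 1))"

text \<open>Any such \<open>C\<close> is finite, so \<open>card C\<close> is its genuine size. Division and subtraction are
  those of \<open>nat\<close>; they agree with the usual bound for \<open>v \<ge> 1\<close> and \<open>k \<ge> 2\<close>.\<close>

definition optimal_optical_orthogonal_code :: "nat \<Rightarrow> nat \<Rightarrow> nat list set \<Rightarrow> bool" where
  "optimal_optical_orthogonal_code v k C \<longleftrightarrow>
     optical_orthogonal_code v k C \<and> card C = (v - 1) div (k * (k - 1))"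

end

theory Submission
  imports Defs
begin

text \<open>
  Put \<open>v = 3k(k-1) + 4\<close>; under either hypothesis an optimal code has three codewords. The
  defining correlation bounds say that the \<open>3k(k-1)\<close> differences \<open>j - i\<close> of distinct support
  positions of a common codeword are pairwise distinct nonzero residues modulo \<open>v\<close>
  (\<open>inj_on_cyclic_diff\<close>), so all but three nonzero residues occur. Since \<open>v\<close> is even, residues
  have a parity. If a codeword has \<open>e\<close> ones in even and \<open>f\<close> ones in odd positions,
  it contributes \<open>2ef\<close> odd differences, and \<open>(e - f)\<^sup>2 = k\<^sup>2 - 4ef\<close>.
  There are only \<open>v/2\<close> odd and \<open>v/2 - 1\<close> nonzero even residues, which pins the total number of
  odd differences down to four consecutive values; hence the sum of the three squares
  \<open>(e - f)\<^sup>2\<close> lies between \<open>3k - 4\<close> and \<open>3k + 2\<close>, and it is congruent to \<open>3k\<^sup>2\<close> modulo \<open>4\<close>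
  (\<open>three_squares_of_code\<close>), hence divisible by \<open>4\<close> as \<open>k\<close> is even. This leaves only the
  values \<open>3k - 2\<close> and \<open>3k + 2\<close> in the first family, and \<open>3k - 4\<close> and \<open>3k\<close> in the second.
  All of these have the form \<open>4\<^sup>n(8m + 7)\<close>, which is never a sum of three squares
  (\<open>sum_three_squares_neq\<close>). The sum of the squares is the sum
  of the squared values of the order-two character of \<open>\<int>/v\<int>\<close> on the codewords.
\<close>

section \<open>Integers that are not sums of three squares\<close>

lemma square_mod_8: "(a::int)\<^sup>2 mod 8 = (if odd a then 1 else if 4 dvd a then 0 else 4)"
proof (cases "even a")
  case True
  then obtain b where b: "a = 2 * b" ..
  show ?thesis
  proof (cases "even b")
    case True
    then obtain c where "b = 2 * c" ..
    then have "a\<^sup>2 = 8 * (2 * c\<^sup>2)" "4 dvd a"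
      using b by (simp_all add: power_mult_distrib)
    then show ?thesis
      using \<open>even a\<close> by simp
  next
    case False
    then obtain c where c: "b = 2 * c + 1" ..
    then have "a\<^sup>2 = 4 + 8 * (2 * c\<^sup>2 + 2 * c)"
      using b by (simp add: power2_eq_square algebra_simps)
    then have "a\<^sup>2 mod 8 = 4"
      by (simp only: mod_mult_self2) simp
    moreover have "\<not> 4 dvd a"
      using b c by presburger
    ultimately show ?thesis
      using \<open>even a\<close> by simp
  qed
next
  case False
  then obtain b where b: "a = 2 * b + 1" ..
  have "even (b * (b + 1))"
    by simp
  then obtain c where "b * (b + 1) = 2 * c" ..
  then have "a\<^sup>2 = 1 + 8 * c"
    using b by (simp add: power2_eq_square algebra_simps)
  then have "a\<^sup>2 mod 8 = 1"
    by (simp only: mod_mult_self2) simp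
  then show ?thesis
    using False by simp
qed

lemma sum_three_squares_mod_8:
  fixes a b c :: int
  shows "(a\<^sup>2 + b\<^sup>2 + c\<^sup>2) mod 8 = (a\<^sup>2 mod 8 + b\<^sup>2 mod 8 + c\<^sup>2 mod 8) mod 8"
  by (intro mod_add_cong) simp_all

lemma even_if_sum_three_squares_dvd_4:
  fixes a b c :: int
  assumes "4 dvd a\<^sup>2 + b\<^sup>2 + c\<^sup>2"
  shows "even a \<and> even b \<and> even c"
proof -
  have "4 dvd (a\<^sup>2 + b\<^sup>2 + c\<^sup>2) mod 8"
    using assms by (simp add: dvd_mod_iff)
  then show ?thesis
    unfolding sum_three_squares_mod_8 square_mod_8 by (simp split: if_splits)
qed

lemma sum_three_squares_neq:
  fixes a b c m :: int
  shows "a\<^sup>2 + b\<^sup>2 + c\<^sup>2 \<noteq> 4 ^ n * (8 * m + 7)"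
proof (induction n arbitrary: a b c)
  case 0
  show ?case
  proof
    assume "a\<^sup>2 + b\<^sup>2 + c\<^sup>2 = 4 ^ 0 * (8 * m + 7)"
    then have "(a\<^sup>2 + b\<^sup>2 + c\<^sup>2) mod 8 = 7"
      by simp
    then show False
      unfolding sum_three_squares_mod_8 square_mod_8 by (simp split: if_splits)
  qed
next
  case (Suc n)
  show ?case
  proof
    assume eq: "a\<^sup>2 + b\<^sup>2 + c\<^sup>2 = 4 ^ Suc n * (8 * m + 7)"
    then have "even a \<and> even b \<and> even c"
      by (intro even_if_sum_three_squares_dvd_4) simp
    then obtain a' b' c' where "a = 2 * a'" "b = 2 * b'" "c = 2 * c'"
      by (auto elim!: evenE)
    then have "a'\<^sup>2 + b'\<^sup>2 + c'\<^sup>2 = 4 ^ n * (8 * m + 7)"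
      using eq by (simp add: power_mult_distrib)
    then show False
      using Suc.IH by blast
  qed
qed

section \<open>Differences of support positions\<close>

definition support :: "nat list \<Rightarrow> nat set" where
  "support x = {i. i < length x \<and> x ! i \<noteq> 0}"

text \<open>The residue of \<open>j - i\<close> modulo \<open>v\<close>, for \<open>i \<le> v\<close>; adding \<open>v\<close> first avoids the truncated
  subtraction.\<close>

definition cyclic_diff :: "nat \<Rightarrow> nat \<Rightarrow> nat \<Rightarrow> nat" where
  "cyclic_diff v i j = (j + v - i) mod v"

text \<open>Ordered pairs of distinct support positions, tagged with their codeword.\<close>

definition position_pairs :: "nat list set \<Rightarrow> (nat list \<times> nat \<times> nat) set" where
  "position_pairs C = (SIGMA x:C. support x \<times> support x - Id)"

definition even_ones :: "nat list \<Rightarrow> nat" where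
  "even_ones x = card {i \<in> support x. even i}"

definition odd_ones :: "nat list \<Rightarrow> nat" where
  "odd_ones x = card {i \<in> support x. odd i}"

lemma finite_support [simp]: "finite (support x)"
  by (simp add: support_def)

lemma cyclic_diff_less: "0 < v \<Longrightarrow> cyclic_diff v i j < v"
  by (simp add: cyclic_diff_def)

lemma add_cyclic_diff: "i < v \<Longrightarrow> j < v \<Longrightarrow> (i + cyclic_diff v i j) mod v = j"
  by (simp add: cyclic_diff_def mod_add_right_eq)

lemma cyclic_diff_eq_0_iff: "i < v \<Longrightarrow> j < v \<Longrightarrow> cyclic_diff v i j = 0 \<longleftrightarrow> i = j"
  using add_cyclic_diff[of i v j] by (auto simp: cyclic_diff_def)

lemma cyclic_diff_translate:
  assumes "i < v" "j < v" "i' < v" "j' < v" "cyclic_diff v i j = cyclic_diff v i' j'"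
  shows "(j + cyclic_diff v i i') mod v = j'"
proof -
  have "(j + cyclic_diff v i i') mod v
      = ((i + cyclic_diff v i j) mod v + cyclic_diff v i i') mod v"
    using assms(1,2) by (simp add: add_cyclic_diff)
  also have "\<dots> = ((i + cyclic_diff v i i') mod v + cyclic_diff v i j) mod v"
    by (simp add: mod_add_left_eq mod_add_right_eq ac_simps)
  also have "\<dots> = j'"
    using assms by (simp add: add_cyclic_diff)
  finally show ?thesis .
qed

lemma even_cyclic_diff:
  assumes "even v" "i < v"
  shows "even (cyclic_diff v i j) \<longleftrightarrow> (even i \<longleftrightarrow> even j)"
  using assms by (auto simp: cyclic_diff_def dvd_mod_iff)

lemma coincidence_unique:
  assumes "correlation v x y \<tau> \<le> 1" "i < v" "j < v"
    and "x ! i \<noteq> 0" "y ! ((i + \<tau>) mod v) \<noteq> 0" "x ! j \<noteq> 0" "y ! ((j + \<tau>) mod v) \<noteq> 0"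
  shows "i = j"
proof (rule ccontr)
  assume "i \<noteq> j"
  let ?f = "\<lambda>i. x ! i * y ! ((i + \<tau>) mod v)"
  have "?f i \<noteq> 0" "?f j \<noteq> 0"
    using assms by simp_all
  then have "2 \<le> ?f i + ?f j"
    by linarith
  also have "\<dots> = sum ?f {i, j}"
    using \<open>i \<noteq> j\<close> by simp
  also have "\<dots> \<le> sum ?f {..<v}"
    using assms by (intro sum_mono2) auto
  finally show False
    using assms(1) by (simp add: correlation_def)
qed

context
  fixes v k :: nat and C :: "nat list set"
  assumes code: "optical_orthogonal_code v k C"
begin

lemma length_codeword: "x \<in> C \<Longrightarrow> length x = v"
  using code by (auto simp: optical_orthogonal_code_def binary_vector_def)

lemma card_support: "x \<in> C \<Longrightarrow> card (support x) = k"
  using code by (auto simp: optical_orthogonal_code_def hamming_weight_def support_def)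

lemma support_less: "x \<in> C \<Longrightarrow> i \<in> support x \<Longrightarrow> i < v"
  using length_codeword by (auto simp: support_def)

lemma finite_code: "finite C"
proof (rule finite_subset)
  show "C \<subseteq> {x. set x \<subseteq> {0, 1} \<and> length x = v}"
    using code by (auto simp: optical_orthogonal_code_def binary_vector_def)
qed (rule finite_lists_length_eq, simp)

text \<open>Two equal differences within one codeword are two coincidences with its shift by that
  difference; in different codewords they are two coincidences of one codeword with a shift
  of the other.\<close>

lemma inj_on_cyclic_diff: "inj_on (\<lambda>(x, i, j). cyclic_diff v i j) (position_pairs C)"
proof (rule inj_onI, unfold split_paired_all prod.case)
  fix x i j x' i' j'
  assume "(x, i, j) \<in> position_pairs C" "(x', i', j') \<in> position_pairs C"
    and eq: "cyclic_diff v i j = cyclic_diff v i' j'"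
  then have x: "x \<in> C" "x' \<in> C"
    and supp: "i \<in> support x" "j \<in> support x" "i' \<in> support x'" "j' \<in> support x'"
    and neq: "i \<noteq> j" "i' \<noteq> j'"
    by (auto simp: position_pairs_def)
  have less: "i < v" "j < v" "i' < v" "j' < v"
    using x supp support_less by blast+
  have nz: "x ! i \<noteq> 0" "x ! j \<noteq> 0" "x' ! i' \<noteq> 0" "x' ! j' \<noteq> 0"
    using supp by (auto simp: support_def)
  have x_eq: "x = x'"
  proof (rule ccontr)
    assume "x \<noteq> x'"
    then have "correlation v x x' (cyclic_diff v i i') \<le> 1"
      using code x less by (auto simp: optical_orthogonal_code_def cyclic_diff_less)
    then have "i = j"
      using less nz eq by (auto intro!: coincidence_unique simp: add_cyclic_diff cyclic_diff_translate)
    then show False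
      using neq by simp
  qed
  have "0 < cyclic_diff v i j" "cyclic_diff v i j < v"
    using less neq by (auto simp: cyclic_diff_eq_0_iff cyclic_diff_less intro: gr0I)
  then have "correlation v x x (cyclic_diff v i j) \<le> 1"
    using code x by (auto simp: optical_orthogonal_code_def)
  moreover have j': "(i' + cyclic_diff v i j) mod v = j'"
    using less eq by (simp add: add_cyclic_diff)
  ultimately have "i = i'"
    using less nz x_eq by (auto intro!: coincidence_unique simp: add_cyclic_diff)
  moreover have "j = j'"
    using j' \<open>i = i'\<close> less by (simp add: add_cyclic_diff)
  ultimately show "(x, i, j) = (x', i', j')"
    using x_eq by simp
qed

section \<open>Counting differences by parity\<close>

lemma even_ones_plus_odd_ones:
  assumes "x \<in> C"
  shows "even_ones x + odd_ones x = k"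
proof -
  have "support x = {i \<in> support x. even i} \<union> {i \<in> support x. odd i}"
    by auto
  then have "card (support x) = even_ones x + odd_ones x"
    unfolding even_ones_def odd_ones_def by (subst card_Un_disjoint[symmetric]) auto
  then show ?thesis
    using assms by (simp add: card_support)
qed

lemma card_position_pairs: "card (position_pairs C) = card C * (k * k - k)"
proof -
  have "card (support x \<times> support x - Id) = k * k - k" if "x \<in> C" for x
  proof -
    have "support x \<times> support x - Id = support x \<times> support x - (\<lambda>i. (i, i)) ` support x"
      by auto
    also have "card \<dots> = card (support x \<times> support x) - card ((\<lambda>i. (i, i)) ` support x)"
      by (rule card_Diff_subset) auto
    also have "card ((\<lambda>i. (i, i)) ` support x) = card (support x)"
      by (rule card_image) (simp add: inj_on_def)
    finally show ?thesis
      using that by (simp add: card_support card_cartesian_product)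
  qed
  then show ?thesis
    unfolding position_pairs_def by (subst card_SigmaI) (auto simp: finite_code)
qed

lemma card_odd_position_pairs:
  "card {(x, i, j) \<in> position_pairs C. even i \<noteq> even j}
    = 2 * (\<Sum>x\<in>C. even_ones x * odd_ones x)"
proof -
  let ?E = "\<lambda>x. {i \<in> support x. even i}" and ?O = "\<lambda>x. {i \<in> support x. odd i}"
  have card_mixed: "card (?E x \<times> ?O x \<union> ?O x \<times> ?E x) = 2 * (even_ones x * odd_ones x)" for x
  proof -
    have "card (?E x \<times> ?O x \<union> ?O x \<times> ?E x) = card (?E x \<times> ?O x) + card (?O x \<times> ?E x)"
    proof (rule card_Un_disjoint)
      show "?E x \<times> ?O x \<inter> ?O x \<times> ?E x = {}"
        by blast
    qed simp_all
    then show ?thesis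
      by (simp add: card_cartesian_product even_ones_def odd_ones_def)
  qed
  have "{(x, i, j) \<in> position_pairs C. even i \<noteq> even j}
      = (SIGMA x:C. ?E x \<times> ?O x \<union> ?O x \<times> ?E x)"
    by (auto simp: position_pairs_def)
  then have "card {(x, i, j) \<in> position_pairs C. even i \<noteq> even j}
      = card (SIGMA x:C. ?E x \<times> ?O x \<union> ?O x \<times> ?E x)"
    by (rule arg_cong)
  also have "\<dots> = (\<Sum>x\<in>C. card (?E x \<times> ?O x \<union> ?O x \<times> ?E x))"
    by (rule card_SigmaI) (auto simp: finite_code)
  also have "\<dots> = (\<Sum>x\<in>C. 2 * (even_ones x * odd_ones x))"
    by (simp only: card_mixed)
  finally show ?thesis
    by (simp add: sum_distrib_left)
qed

text \<open>With \<open>v = 2h\<close>, the odd differences inject into the \<open>h\<close> odd residues, and the even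
  differences into the \<open>h - 1\<close> nonzero even residues.\<close>

lemma odd_differences_bounds:
  assumes v: "v = 2 * h" "0 < h"
  shows "2 * (\<Sum>x\<in>C. even_ones x * odd_ones x) \<le> h"
    and "card C * (k * k - k) \<le> 2 * (\<Sum>x\<in>C. even_ones x * odd_ones x) + (h - 1)"
proof -
  let ?N = "2 * (\<Sum>x\<in>C. even_ones x * odd_ones x)"
  let ?d = "\<lambda>(x :: nat list, i, j). cyclic_diff v i j"
  let ?P = "{(x, i, j) \<in> position_pairs C. even i \<noteq> even j}"
  let ?Q = "position_pairs C - ?P"
  have less: "i < v" "j < v" "i \<noteq> j" if "(x, i, j) \<in> position_pairs C" for x i j
    using that support_less by (auto simp: position_pairs_def)
  have "finite (position_pairs C)"
    unfolding position_pairs_def by (auto simp: finite_code)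
  have "?d ` ?P \<subseteq> (\<lambda>t. 2 * t + 1) ` {..<h}"
  proof (rule image_subsetI, unfold split_paired_all prod.case)
    fix x i j
    assume "(x, i, j) \<in> {(x, i, j) \<in> position_pairs C. even i \<noteq> even j}"
    then have pair: "(x, i, j) \<in> position_pairs C" and parity: "even i \<noteq> even j"
      by auto
    have "i < v"
      using less[OF pair] by simp
    then have "odd (cyclic_diff v i j)" "cyclic_diff v i j < 2 * h"
      using parity v cyclic_diff_less[of v i j] by (simp_all add: even_cyclic_diff)
    then show "cyclic_diff v i j \<in> (\<lambda>t. 2 * t + 1) ` {..<h}"
      by (auto elim!: oddE)
  qed
  then have "card ?P \<le> card ((\<lambda>t. 2 * t + 1) ` {..<h})"
    by (rule card_inj_on_le[rotated]) (auto intro: inj_on_subset[OF inj_on_cyclic_diff])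
  also have "\<dots> \<le> h"
    using card_image_le[of "{..<h}" "\<lambda>t. 2 * t + 1"] by simp
  finally show "?N \<le> h"
    by (simp only: card_odd_position_pairs)
  have "?d ` ?Q \<subseteq> (\<lambda>t. 2 * t) ` {1..<h}"
  proof (rule image_subsetI, unfold split_paired_all prod.case)
    fix x i j
    assume "(x, i, j) \<in> position_pairs C - {(x, i, j) \<in> position_pairs C. even i \<noteq> even j}"
    then have pair: "(x, i, j) \<in> position_pairs C" and parity: "even i \<longleftrightarrow> even j"
      by auto
    then have "even (cyclic_diff v i j)"
      using less[OF pair] v by (simp add: even_cyclic_diff)
    moreover have "cyclic_diff v i j < 2 * h" "cyclic_diff v i j \<noteq> 0"
      using less[OF pair] v cyclic_diff_less[of v i j] by (simp_all add: cyclic_diff_eq_0_iff)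
    ultimately show "cyclic_diff v i j \<in> (\<lambda>t. 2 * t) ` {1..<h}"
      by (auto elim!: evenE)
  qed
  then have "card ?Q \<le> card ((\<lambda>t. 2 * t) ` {1..<h})"
    by (rule card_inj_on_le[rotated]) (auto intro: inj_on_subset[OF inj_on_cyclic_diff])
  also have "\<dots> \<le> h - 1"
    using card_image_le[of "{1..<h}" "\<lambda>t. 2 * t"] by simp
  finally have "card ?Q \<le> h - 1" .
  moreover have "card (position_pairs C) - card ?P \<le> card ?Q"
    by (rule diff_card_le_card_Diff)
      (auto intro: finite_subset[OF _ \<open>finite (position_pairs C)\<close>])
  ultimately show "card C * (k * k - k) \<le> ?N + (h - 1)"
    unfolding card_position_pairs card_odd_position_pairs by linarith
qed

lemma sum_squares_imbalance:
  "(\<Sum>x\<in>C. (int (even_ones x) - int (odd_ones x))\<^sup>2)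
    = int (card C) * (int k)\<^sup>2 - 4 * int (\<Sum>x\<in>C. even_ones x * odd_ones x)"
proof -
  have "(\<Sum>x\<in>C. (int (even_ones x) - int (odd_ones x))\<^sup>2)
      = (\<Sum>x\<in>C. (int k)\<^sup>2 - 4 * (int (even_ones x) * int (odd_ones x)))"
  proof (rule sum.cong[OF refl])
    fix x assume "x \<in> C"
    then have "int k = int (even_ones x) + int (odd_ones x)"
      using even_ones_plus_odd_ones by (metis of_nat_add)
    then show "(int (even_ones x) - int (odd_ones x))\<^sup>2
        = (int k)\<^sup>2 - 4 * (int (even_ones x) * int (odd_ones x))"
      by (simp add: power2_eq_square algebra_simps)
  qed
  then show ?thesis
    by (simp add: sum_subtractf sum_distrib_left)
qed

lemma three_squares_of_code:
  assumes v: "v = 3 * k * (k - 1) + 4" and card: "card C = 3"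
  obtains a b c t :: int where
    "a\<^sup>2 + b\<^sup>2 + c\<^sup>2 = 3 * (int k)\<^sup>2 - 4 * t"
    "3 * int k - 4 \<le> a\<^sup>2 + b\<^sup>2 + c\<^sup>2" "a\<^sup>2 + b\<^sup>2 + c\<^sup>2 \<le> 3 * int k + 2"
proof -
  have "even (k * k - k)"
    by (cases k) auto
  then obtain r where r: "k * k - k = 2 * r" ..
  have "k * (k - 1) = 2 * r"
    using r by (simp add: diff_mult_distrib2)
  then have v': "v = 2 * (3 * r + 2)"
    using v by (simp add: mult.assoc)
  have k_sq: "(int k)\<^sup>2 = 2 * int r + int k"
  proof -
    have "k * k = 2 * r + k"
      using r le_square[of k] by linarith
    then show ?thesis
      unfolding power2_eq_square by (metis of_nat_add of_nat_mult of_nat_numeral)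
  qed
  define M where "M = (\<Sum>x\<in>C. even_ones x * odd_ones x)"
  have bounds: "2 * M \<le> 3 * r + 2" "6 * r \<le> 2 * M + (3 * r + 1)"
    using odd_differences_bounds[OF v'] card r by (simp_all add: M_def)
  obtain x y z where C: "C = {x, y, z}" and distinct: "x \<noteq> y" "x \<noteq> z" "y \<noteq> z"
    using card by (auto simp: card_3_iff)
  define f where "f = (\<lambda>x. int (even_ones x) - int (odd_ones x))"
  have "(f x)\<^sup>2 + (f y)\<^sup>2 + (f z)\<^sup>2 = (\<Sum>x\<in>C. (f x)\<^sup>2)"
    using distinct by (simp add: C)
  also have "\<dots> = 3 * (int k)\<^sup>2 - 4 * int M"
    using sum_squares_imbalance card by (simp add: f_def M_def)
  finally have eq: "(f x)\<^sup>2 + (f y)\<^sup>2 + (f z)\<^sup>2 = 3 * (int k)\<^sup>2 - 4 * int M" .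
  show thesis
    by (rule that[OF eq]) (use eq k_sq bounds in linarith)+
qed

end

section \<open>Nonexistence\<close>

lemma optimal_code_three_squares:
  assumes opt: "optimal_optical_orthogonal_code (3 * k * (k - 1) + 4) k C"
    and k: "even k" "4 \<le> k"
  obtains a b c :: int where
    "4 dvd a\<^sup>2 + b\<^sup>2 + c\<^sup>2"
    "3 * int k - 4 \<le> a\<^sup>2 + b\<^sup>2 + c\<^sup>2" "a\<^sup>2 + b\<^sup>2 + c\<^sup>2 \<le> 3 * int k + 2"
proof -
  have code: "optical_orthogonal_code (3 * k * (k - 1) + 4) k C"
    using opt by (simp add: optimal_optical_orthogonal_code_def)
  have "4 * 3 \<le> k * (k - 1)"
    using k by (intro mult_le_mono) auto
  then have "(3 * (k * (k - 1)) + 3) div (k * (k - 1)) = 3"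
    by (intro div_nat_eqI) auto
  then have "card C = 3"
    using opt by (simp add: optimal_optical_orthogonal_code_def mult.assoc add.commute)
  from three_squares_of_code[OF code refl this] obtain a b c t :: int where
    eq: "a\<^sup>2 + b\<^sup>2 + c\<^sup>2 = 3 * (int k)\<^sup>2 - 4 * t"
    and bounds: "3 * int k - 4 \<le> a\<^sup>2 + b\<^sup>2 + c\<^sup>2" "a\<^sup>2 + b\<^sup>2 + c\<^sup>2 \<le> 3 * int k + 2" .
  obtain l where "k = 2 * l"
    using k by (auto elim: evenE)
  then have "a\<^sup>2 + b\<^sup>2 + c\<^sup>2 = 4 * (3 * (int l)\<^sup>2 - t)"
    using eq by (simp add: power_mult_distrib)
  then have "4 dvd a\<^sup>2 + b\<^sup>2 + c\<^sup>2"
    by simp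
  then show thesis
    using that bounds by blast
qed

theorem theorem4p11:
  fixes k :: nat
  assumes "(\<exists>a c :: nat. real k = (4 ^ (a + 3) * (24 * real c + 23) - 2) / 3)
         \<or> (\<exists>a c :: nat. k = 4 ^ (a + 3) * (8 * c + 5))"
  shows "\<not> (\<exists>C. optimal_optical_orthogonal_code (3 * k * (k - 1) + 4) k C)"
proof
  assume "\<exists>C. optimal_optical_orthogonal_code (3 * k * (k - 1) + 4) k C"
  then obtain C where opt: "optimal_optical_orthogonal_code (3 * k * (k - 1) + 4) k C"
    by blast
  from assms show False
  proof (elim disjE exE)
    fix a c :: nat
    assume "real k = (4 ^ (a + 3) * (24 * real c + 23) - 2) / 3"
    then have "real (3 * k + 2) = real (4 ^ (a + 3) * (24 * c + 23))"
      by simp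
    then have k_nat: "3 * k + 2 = 4 ^ (a + 3) * (24 * c + 23)"
      by (simp only: of_nat_eq_iff)
    define q where "q = 4 ^ a * (24 * c + 23)"
    have q: "3 * k + 2 = 64 * q" "1 \<le> q"
      using k_nat by (simp_all add: q_def power_add)
    have "4 \<le> k"
      using q by linarith
    have "even (3 * k + 2)"
      unfolding q by simp
    then have "even k"
      by simp
    from optimal_code_three_squares[OF opt \<open>even k\<close> \<open>4 \<le> k\<close>] obtain x y z :: int where
      dvd: "4 dvd x\<^sup>2 + y\<^sup>2 + z\<^sup>2" and bounds:
      "3 * int k - 4 \<le> x\<^sup>2 + y\<^sup>2 + z\<^sup>2" "x\<^sup>2 + y\<^sup>2 + z\<^sup>2 \<le> 3 * int k + 2" .
    obtain s where s: "x\<^sup>2 + y\<^sup>2 + z\<^sup>2 = 4 * s"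
      using dvd ..
    have "3 * int k + 2 = 64 * int q"
      using q by linarith
    \<comment> \<open>The multiples of \<open>4\<close> between \<open>3k - 4 = 64q - 6\<close> and \<open>3k + 2 = 64q\<close>.\<close>
    then have "s = 16 * int q \<or> s = 16 * int q - 1"
      using s bounds by linarith
    then have "x\<^sup>2 + y\<^sup>2 + z\<^sup>2 = 64 * int q \<or> x\<^sup>2 + y\<^sup>2 + z\<^sup>2 = 64 * int q - 4"
      using s by auto
    moreover have "64 * int q = 4 ^ (a + 3) * (8 * (3 * int c + 2) + 7)"
      by (simp add: q_def power_add)
    moreover have "64 * int q - 4 = 4 ^ 1 * (8 * (2 * int q - 1) + 7)"
      by simp
    ultimately show False
      using sum_three_squares_neq[of x y z "a + 3" "3 * int c + 2"]
        sum_three_squares_neq[of x y z 1 "2 * int q - 1"] by presburger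
  next
    fix a c :: nat
    assume k_nat: "k = 4 ^ (a + 3) * (8 * c + 5)"
    define q where "q = 4 ^ a * (8 * c + 5)"
    have q: "k = 64 * q" "1 \<le> q"
      using k_nat by (simp_all add: q_def power_add)
    then have "even k" "4 \<le> k"
      by simp_all
    from optimal_code_three_squares[OF opt \<open>even k\<close> \<open>4 \<le> k\<close>] obtain x y z :: int where
      dvd: "4 dvd x\<^sup>2 + y\<^sup>2 + z\<^sup>2" and bounds:
      "3 * int k - 4 \<le> x\<^sup>2 + y\<^sup>2 + z\<^sup>2" "x\<^sup>2 + y\<^sup>2 + z\<^sup>2 \<le> 3 * int k + 2" .
    obtain s where s: "x\<^sup>2 + y\<^sup>2 + z\<^sup>2 = 4 * s"
      using dvd ..
    have "int k = 64 * int q"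
      using q by linarith
    \<comment> \<open>The multiples of \<open>4\<close> between \<open>3k - 4 = 192q - 4\<close> and \<open>3k + 2 = 192q + 2\<close>.\<close>
    then have "s = 48 * int q \<or> s = 48 * int q - 1"
      using s bounds by linarith
    then have "x\<^sup>2 + y\<^sup>2 + z\<^sup>2 = 192 * int q \<or> x\<^sup>2 + y\<^sup>2 + z\<^sup>2 = 192 * int q - 4"
      using s by auto
    moreover have "192 * int q = 4 ^ (a + 3) * (8 * (3 * int c + 1) + 7)"
      by (simp add: q_def power_add algebra_simps)
    moreover have "192 * int q - 4 = 4 ^ 1 * (8 * (6 * int q - 1) + 7)"
      by simp
    ultimately show False
      using sum_three_squares_neq[of x y z "a + 3" "3 * int c + 1"]
        sum_three_squares_neq[of x y z 1 "6 * int q - 1"] by presburger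
  qed
qed

end
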